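(* Let $E\subset\mathbb{R}^n$ be open, let $L$ be a continuous vector field on $E$, and let $q:E\to\mathbb{R}$ be continuous. Let $\eta(x_1,\dots,x_n)$ and $\eta_j(x_1,\dots,x_n)$ ($j=1,\dots,n-1$) be functionally independent solutions of $(L+q)\psi=0$, where $\eta$ has no zeros in $E$. Then: 1. the ratios $\phi_j=\eta_j/\eta$ ($j=1,\dots,n-1$) are solutions of $L\phi=0$, and they are functionally independent; 2. $\phi=f(\eta_1/\eta,\dots,\eta_{n-1}/\eta)$ is the general solution of the homogeneous equation $L\phi=0$, and $\psi=\eta\,f(\eta_1/\eta,\dots,\eta_{n-1}/\eta)$ is the general solution of the non-homogeneous equation $(L+q)\psi=0$, where $f$ is an arbitrary $C^1$ function in its arguments; 3. if $\eta_n$ is a further solution of $(L+q)\psi=0$, then $\eta_n/\eta=f_0(\eta_1/\eta,\dots,\eta_{n-1}/\eta)$, where $f_0$ is some specified $C^1$ function.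
   Context: In a global system of coordinates $(x_1,\dots,x_n)$ on $E$, $L=\sum_{k=1}^n a_k(x_1,\dots,x_n)\,\partial/\partial x_k$ with $a_k\in C^0(E)$. It acts on $C^1(E)$ by $L\psi=\sum_k a_k\,\partial\psi/\partial x_k$, and $(L+q)\psi=L\psi+q\psi$. Solutions are $C^1$ functions on $E$. "Functionally independent" has its usual meaning (linearly independent differentials). "General solution" means that the functions of the indicated form, as $f$ varies, are the solutions of the equation.
   Formalization: False as stated: "general solution" in 2 (that every solution has the given form) and 3 are proved only if L vanishes on no nonempty open subset of E, and then locally near each point of E; globally on E only if the level sets of (η_1/η,…,η_{n-1}/η) in E are connected. *)

theory Defs
  imports "HOL-Analysis.Analysis"
begin

definition C1_on :: "'a::real_normed_vector set \<Rightarrow> ('a \<Rightarrow> real) \<Rightarrow> bool" where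
  "C1_on S f \<longleftrightarrow>
     (\<exists>f' :: 'a \<Rightarrow> ('a \<Rightarrow>\<^sub>L real).
        (\<forall>x\<in>S. (f has_derivative blinfun_apply (f' x)) (at x)) \<and> continuous_on S f')"

definition partial :: "'n \<Rightarrow> (real^'n \<Rightarrow> real) \<Rightarrow> real^'n \<Rightarrow> real" where
  "partial k \<psi> x = deriv (\<lambda>t. \<psi> (x + t *\<^sub>R axis k 1)) 0"

definition vector_field :: "(real^'n \<Rightarrow> real^'n) \<Rightarrow> (real^'n \<Rightarrow> real) \<Rightarrow> real^'n \<Rightarrow> real" where
  "vector_field a \<psi> x = (\<Sum>k\<in>UNIV. a x $ k * partial k \<psi> x)"

(* Solutions of (L + q) \<psi> = 0 on S; the equation L \<phi> = 0 is the case q = 0. *)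
definition solution_on ::
  "(real^'n) set \<Rightarrow> (real^'n \<Rightarrow> real^'n) \<Rightarrow> (real^'n \<Rightarrow> real) \<Rightarrow> (real^'n \<Rightarrow> real) \<Rightarrow> bool" where
  "solution_on S a q \<psi> \<longleftrightarrow>
     C1_on S \<psi> \<and> (\<forall>x\<in>S. vector_field a \<psi> x + q x * \<psi> x = 0)"

(* Linear independence, at every point of S, of the differentials of the indexed family
   (g i), i in I; as a family, so that equal members count as dependent. *)
definition functionally_independent_on ::
  "'a::real_normed_vector set \<Rightarrow> 'i set \<Rightarrow> ('i \<Rightarrow> 'a \<Rightarrow> real) \<Rightarrow> bool" where
  "functionally_independent_on S I g \<longleftrightarrow>
     (\<forall>x\<in>S. \<forall>c :: 'i \<Rightarrow> real.
        (\<forall>v. (\<Sum>i\<in>I. c i * frechet_derivative (g i) (at x) v) = 0) \<longrightarrow> (\<forall>i\<in>I. c i = 0))"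

(* The n - 1 functions \<eta>\<^sub>j are indexed by a set J with n - 1 elements in some finite type 'm, and
   (\<eta>\<^sub>j / \<eta>) for j in J is a point of real^'m whose coordinates outside J are 0. For n >= 2 one
   may take J = UNIV, and then real^'m is R^(n-1). The detour through J keeps n = 1, where there
   are no arguments (J = {}), since finite types are not empty. A C1 function of the arguments
   (y\<^sub>j), j in J, extends to a C1 function on real^'m not depending on the other coordinates. *)
definition ratios ::
  "'m set \<Rightarrow> ('x \<Rightarrow> real) \<Rightarrow> ('m \<Rightarrow> 'x \<Rightarrow> real) \<Rightarrow> 'x \<Rightarrow> real^'m" where
  "ratios J \<eta> \<eta>s x = (\<chi> j. if j \<in> J then \<eta>s j x / \<eta> x else 0)"

(* f is a C1 function, defined on some open set containing the values that \<Phi> takes on S. *)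
definition C1_function_of ::
  "'x set \<Rightarrow> ('x \<Rightarrow> 'y::real_normed_vector) \<Rightarrow> ('y \<Rightarrow> real) \<Rightarrow> bool" where
  "C1_function_of S \<Phi> f \<longleftrightarrow> (\<exists>W. open W \<and> \<Phi> ` S \<subseteq> W \<and> C1_on W f)"

(* The solutions of (L + q) \<psi> = 0 on S are exactly the functions \<open>form f\<close>, for f a C1 function of
   the arguments \<Phi>. *)
definition general_solution_on ::
  "(real^'n) set \<Rightarrow> (real^'n \<Rightarrow> real^'n) \<Rightarrow> (real^'n \<Rightarrow> real) \<Rightarrow> (real^'n \<Rightarrow> real^'m) \<Rightarrow>
     ((real^'m \<Rightarrow> real) \<Rightarrow> real^'n \<Rightarrow> real) \<Rightarrow> bool" where
  "general_solution_on S a q \<Phi> form \<longleftrightarrow>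
     (\<forall>\<psi>. solution_on S a q \<psi> \<longleftrightarrow>
        (\<exists>f. C1_function_of S \<Phi> f \<and> (\<forall>x\<in>S. \<psi> x = form f x)))"

(* P holds on arbitrarily small open neighbourhoods of every point of the open set S. *)
definition locally_on :: "'a::topological_space set \<Rightarrow> ('a set \<Rightarrow> bool) \<Rightarrow> bool" where
  "locally_on S P \<longleftrightarrow>
     (\<forall>p\<in>S. \<forall>V. open V \<and> p \<in> V \<longrightarrow> (\<exists>U. open U \<and> p \<in> U \<and> U \<subseteq> V \<inter> S \<and> P U))"

(* Without this, L could vanish on an open set, where every C1 function solves L \<phi> = 0. *)
definition nowhere_locally_zero :: "'a::topological_space set \<Rightarrow> ('a \<Rightarrow> 'b::zero) \<Rightarrow> bool" where
  "nowhere_locally_zero S a \<longleftrightarrow>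
     (\<forall>U. open U \<and> U \<subseteq> S \<and> U \<noteq> {} \<longrightarrow> (\<exists>x\<in>U. a x \<noteq> 0))"

(* A solution of L \<phi> = 0 is constant along each connected component of a level set of \<Phi>, but it
   may differ between components; so a single f on the whole of S needs connected level sets. *)
definition connected_level_sets :: "'a::topological_space set \<Rightarrow> ('a \<Rightarrow> 'b) \<Rightarrow> bool" where
  "connected_level_sets S \<Phi> \<longleftrightarrow> (\<forall>y. connected {x \<in> S. \<Phi> x = y})"

end

theory Submission
  imports Defs
begin

text \<open>
  Dividing a solution of \<open>(L + q) \<psi> = 0\<close> by the zero-free solution \<open>\<eta>\<close> gives a solution of
  \<open>L \<phi> = 0\<close>, and multiplying by \<open>\<eta>\<close> goes back; the terms with \<open>q\<close> cancel in the quotient rule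
  (\<open>solution_on_ratio\<close>, \<open>solution_on_mult\<close>). So everything reduces to the equation \<open>L \<phi> = 0\<close>,
  which says that the derivative of \<open>\<phi>\<close> vanishes in the direction \<open>a x\<close> at every \<open>x\<close>.

  The differentials of the \<open>n\<close> functions \<open>\<eta>\<close> and \<open>\<eta>\<^sub>j / \<eta>\<close> are again independent, since they arise
  from those of \<open>\<eta>\<close> and \<open>\<eta>\<^sub>j\<close> by an invertible change (\<open>functionally_independent_ratios\<close>). By the
  inverse function theorem, \<open>F = (\<Phi>, \<eta>)\<close> is therefore a local coordinate system everywhere, in
  which \<open>\<Phi>\<close> consists of the first \<open>n - 1\<close> coordinates and the denominator \<open>\<eta>\<close> is the last one.
  As \<open>L\<close> annihilates \<open>\<Phi>\<close>, in these coordinates it is a multiple of the derivative with respect to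
  the last coordinate. A solution of \<open>L \<phi> = 0\<close> thus has zero derivative in that
  coordinate wherever \<open>a\<close> does not vanish. If \<open>a\<close> is nowhere locally zero, such points are dense,
  and by continuity the derivative vanishes everywhere. On a neighbourhood that is a ball in the new
  coordinates, the solution depends on \<open>\<Phi>\<close> only (\<open>local_factorization\<close>), and the function \<open>f\<close> with \<open>\<phi> x = f (\<Phi> x)\<close> is
  obtained by composing \<open>\<phi>\<close> with the local section \<open>\<sigma>\<close> of \<open>\<Phi>\<close> that keeps the last coordinate fixed.

  If the level sets of \<open>\<Phi>\<close> are connected, the local statement makes \<open>\<phi>\<close> constant on each of them.
  This defines a single \<open>f\<close>, which agrees near every value of \<open>\<Phi>\<close> with one of the local functions
  \<open>\<phi> \<circ> \<sigma>\<close> and so is continuously differentiable (\<open>solution_factors_globally\<close>).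

  To stay within one Euclidean space, \<open>\<Phi>\<close> is embedded by a linear map \<open>G\<close> into the hyperplane of
  \<open>\<real>\<^sup>n\<close> orthogonal to a basis vector \<open>e\<close>, and \<open>F x = G (\<Phi> x) + \<eta> x *\<^sub>R e\<close>. Since \<open>G\<close> ignores the
  coordinates outside \<open>J\<close>, functions of \<open>G y\<close> automatically extend \<open>f\<close> to an open subset of the whole
  space \<open>real^'m\<close>.
\<close>

section \<open>Continuously differentiable maps\<close>

definition C1_map_on :: "'a::real_normed_vector set \<Rightarrow> ('a \<Rightarrow> 'b::real_normed_vector) \<Rightarrow> bool" where
  "C1_map_on S f \<longleftrightarrow>
     (\<exists>f' :: 'a \<Rightarrow> ('a \<Rightarrow>\<^sub>L 'b).
        (\<forall>x\<in>S. (f has_derivative blinfun_apply (f' x)) (at x)) \<and> continuous_on S f')"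

lemma C1_on_iff_C1_map_on: "C1_on S f \<longleftrightarrow> C1_map_on S f"
  by (simp add: C1_on_def C1_map_on_def)

lemma C1_map_onI:
  assumes "\<And>x. x \<in> S \<Longrightarrow> (f has_derivative blinfun_apply (f' x)) (at x)" "continuous_on S f'"
  shows "C1_map_on S f"
  using assms by (auto simp: C1_map_on_def)

lemma C1_map_onE:
  assumes "C1_map_on S f"
  obtains f' where "\<And>x. x \<in> S \<Longrightarrow> (f has_derivative blinfun_apply (f' x)) (at x)"
    "continuous_on S f'"
  using assms by (auto simp: C1_map_on_def)

lemma C1_map_on_subset: "C1_map_on T f \<Longrightarrow> S \<subseteq> T \<Longrightarrow> C1_map_on S f"
  unfolding C1_map_on_def by (meson continuous_on_subset subsetD)

lemma C1_map_on_has_derivative: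
  assumes "C1_map_on S f" "x \<in> S"
  shows "(f has_derivative frechet_derivative f (at x)) (at x)"
  using assms by (auto simp: C1_map_on_def frechet_derivative_works[symmetric] differentiable_def)

lemma C1_map_on_continuous_on: "C1_map_on S f \<Longrightarrow> continuous_on S f"
  by (meson C1_map_on_has_derivative continuous_at_imp_continuous_on has_derivative_continuous)

lemma C1_map_on_continuous_frechet:
  assumes "C1_map_on S f"
  shows "continuous_on S (\<lambda>x. Blinfun (frechet_derivative f (at x)))"
proof -
  obtain f' where f': "\<And>x. x \<in> S \<Longrightarrow> (f has_derivative blinfun_apply (f' x)) (at x)"
    and c: "continuous_on S f'"
    using assms by (rule C1_map_onE) blast
  have "Blinfun (frechet_derivative f (at x)) = f' x" if "x \<in> S" for x
    by (simp add: blinfun_apply_inverse flip: frechet_derivative_at[OF f'[OF that]])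
  then show ?thesis
    using c by (simp cong: continuous_on_cong)
qed

text \<open>The pointwise derivatives are unique, so the derivatives on the various neighbourhoods fit
  together to one continuous map.\<close>

lemma C1_map_on_locally:
  assumes "\<And>x. x \<in> S \<Longrightarrow> \<exists>T. open T \<and> x \<in> T \<and> C1_map_on T f"
  shows "C1_map_on S f"
proof (rule C1_map_onI)
  let ?f' = "\<lambda>x. Blinfun (frechet_derivative f (at x))"
  show "(f has_derivative blinfun_apply (?f' x)) (at x)" if "x \<in> S" for x
  proof -
    have "(f has_derivative frechet_derivative f (at x)) (at x)"
      using assms[OF that] C1_map_on_has_derivative by blast
    then show ?thesis
      by (simp add: bounded_linear_Blinfun_apply has_derivative_bounded_linear)
  qed
  show "continuous_on S ?f'"
  proof (rule continuous_at_imp_continuous_on, rule ballI)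
    fix x assume "x \<in> S"
    then obtain T where "open T" "x \<in> T" "C1_map_on T f"
      using assms by blast
    then show "isCont ?f' x"
      using C1_map_on_continuous_frechet continuous_on_eq_continuous_at by blast
  qed
qed

lemma C1_map_on_cong_open:
  assumes "C1_map_on S f" "open S" "\<And>x. x \<in> S \<Longrightarrow> f x = g x"
  shows "C1_map_on S g"
proof -
  obtain f' where f': "\<And>x. x \<in> S \<Longrightarrow> (f has_derivative blinfun_apply (f' x)) (at x)"
    and c: "continuous_on S f'"
    using assms(1) by (rule C1_map_onE) blast
  show ?thesis
    using has_derivative_transform_within_open[OF f' \<open>open S\<close>] assms(3) c
    by (intro C1_map_onI[of S g f']) auto
qed

lemma C1_map_on_compose:
  assumes "C1_map_on S f" "C1_map_on T g" "f ` S \<subseteq> T"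
  shows "C1_map_on S (\<lambda>x. g (f x))"
proof -
  obtain f' where f': "\<And>x. x \<in> S \<Longrightarrow> (f has_derivative blinfun_apply (f' x)) (at x)"
    and cf: "continuous_on S f'"
    using assms(1) by (rule C1_map_onE) blast
  obtain g' where g': "\<And>x. x \<in> T \<Longrightarrow> (g has_derivative blinfun_apply (g' x)) (at x)"
    and cg: "continuous_on T g'"
    using assms(2) by (rule C1_map_onE) blast
  show ?thesis
  proof (rule C1_map_onI[where f'="\<lambda>x. g' (f x) o\<^sub>L f' x"])
    fix x assume "x \<in> S"
    then have "f x \<in> T" using assms(3) by blast
    have "(\<lambda>v. blinfun_apply (g' (f x)) (blinfun_apply (f' x) v))
        = blinfun_apply (g' (f x) o\<^sub>L f' x)"
      by auto
    then show "((\<lambda>x. g (f x)) has_derivative blinfun_apply (g' (f x) o\<^sub>L f' x)) (at x)"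
      using has_derivative_compose[OF f'[OF \<open>x \<in> S\<close>] g'[OF \<open>f x \<in> T\<close>]] by simp
  next
    have "continuous_on S (\<lambda>x. g' (f x))"
      using continuous_on_compose2[OF cg C1_map_on_continuous_on[OF assms(1)] assms(3)] .
    then show "continuous_on S (\<lambda>x. g' (f x) o\<^sub>L f' x)"
      using cf by (rule bounded_bilinear.continuous_on[OF bounded_bilinear_blinfun_compose])
  qed
qed

lemma C1_map_on_bounded_linear:
  assumes "bounded_linear f"
  shows "C1_map_on S f"
  using assms
  by (intro C1_map_onI[where f'="\<lambda>_. Blinfun f"])
    (auto simp: bounded_linear_Blinfun_apply bounded_linear_imp_has_derivative)

lemma C1_map_on_add:
  assumes "C1_map_on S f" "C1_map_on S g"
  shows "C1_map_on S (\<lambda>x. f x + g x)"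
proof -
  obtain f' where f': "\<And>x. x \<in> S \<Longrightarrow> (f has_derivative blinfun_apply (f' x)) (at x)"
    and cf: "continuous_on S f'"
    using assms(1) by (rule C1_map_onE) blast
  obtain g' where g': "\<And>x. x \<in> S \<Longrightarrow> (g has_derivative blinfun_apply (g' x)) (at x)"
    and cg: "continuous_on S g'"
    using assms(2) by (rule C1_map_onE) blast
  show ?thesis
    by (rule C1_map_onI[where f'="\<lambda>x. f' x + g' x"])
      (auto intro!: derivative_eq_intros f' g' continuous_intros cf cg simp: blinfun.add_left)
qed

lemma C1_map_on_const: "C1_map_on S (\<lambda>_. c)"
  by (rule C1_map_onI[where f'="\<lambda>_. 0"]) (auto simp: zero_blinfun.rep_eq)

lemma C1_map_on_sum:
  "(\<And>i. i \<in> I \<Longrightarrow> C1_map_on S (f i)) \<Longrightarrow> C1_map_on S (\<lambda>x. \<Sum>i\<in>I. f i x)"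
  by (induction I rule: infinite_finite_induct) (auto intro!: C1_map_on_add C1_map_on_const)

lemma C1_map_on_componentwise:
  fixes f :: "'a::real_normed_vector \<Rightarrow> real^'k"
  assumes "\<And>i. C1_map_on S (\<lambda>x. f x $ i)"
  shows "C1_map_on S f"
proof -
  have "C1_map_on S (\<lambda>x. \<Sum>i\<in>UNIV. (f x $ i) *\<^sub>R axis i (1::real))"
    by (intro C1_map_on_sum
        C1_map_on_compose[OF assms C1_map_on_bounded_linear[OF bounded_linear_scaleR_left] subset_UNIV])
  moreover have "(\<lambda>x. \<Sum>i\<in>UNIV. (f x $ i) *\<^sub>R axis i (1::real)) = f"
    by (auto simp: fun_eq_iff vec_eq_iff axis_def if_distrib cong: if_cong)
  ultimately show ?thesis by simp
qed

lemma C1_map_on_mult: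
  fixes f g :: "'a::real_normed_vector \<Rightarrow> real"
  assumes "C1_map_on S f" "C1_map_on S g"
  shows "C1_map_on S (\<lambda>x. f x * g x)"
proof -
  obtain f' where f': "\<And>x. x \<in> S \<Longrightarrow> (f has_derivative blinfun_apply (f' x)) (at x)"
    and cf: "continuous_on S f'"
    using assms(1) by (rule C1_map_onE) blast
  obtain g' where g': "\<And>x. x \<in> S \<Longrightarrow> (g has_derivative blinfun_apply (g' x)) (at x)"
    and cg: "continuous_on S g'"
    using assms(2) by (rule C1_map_onE) blast
  have cont: "continuous_on S f" "continuous_on S g"
    using assms by (auto intro: C1_map_on_continuous_on)
  show ?thesis
    by (rule C1_map_onI[where f'="\<lambda>x. f x *\<^sub>R g' x + g x *\<^sub>R f' x"])
      (auto intro!: derivative_eq_intros f' g' continuous_intros cf cg cont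
        simp: blinfun.add_left blinfun.scaleR_left algebra_simps)
qed

lemma C1_map_on_divide:
  fixes f g :: "'a::real_normed_vector \<Rightarrow> real"
  assumes "C1_map_on S f" "C1_map_on S g" "\<And>x. x \<in> S \<Longrightarrow> g x \<noteq> 0"
  shows "C1_map_on S (\<lambda>x. f x / g x)"
proof -
  have "C1_map_on (- {0}) (inverse :: real \<Rightarrow> real)"
    by (rule C1_map_onI[where f'="\<lambda>x. blinfun_scaleR_left (- (inverse x * inverse x))"])
      (auto intro!: derivative_eq_intros continuous_intros
        bounded_linear.continuous_on[OF bounded_linear_blinfun_scaleR_left])
  then have "C1_map_on S (\<lambda>x. inverse (g x))"
    by (rule C1_map_on_compose[OF assms(2)]) (use assms(3) in auto)
  then show ?thesis
    using C1_map_on_mult[OF assms(1)] by (simp add: divide_inverse)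
qed

text \<open>From \<open>B y - B z = B y (A z - A y) B z\<close>: once \<open>norm (A y - A z) * norm (B z) \<le> 1 / 2\<close>, the
  factor \<open>B y\<close> on the right can be absorbed, which bounds \<open>norm (B y - B z)\<close> by a multiple of
  \<open>norm (A y - A z)\<close>.\<close>

lemma continuous_on_blinfun_inverse:
  fixes A B :: "'t::topological_space \<Rightarrow> ('a::real_normed_vector \<Rightarrow>\<^sub>L 'a)"
  assumes A: "continuous_on S A"
    and BA: "\<And>y. y \<in> S \<Longrightarrow> B y o\<^sub>L A y = id_blinfun"
    and AB: "\<And>y. y \<in> S \<Longrightarrow> A y o\<^sub>L B y = id_blinfun"
  shows "continuous_on S B"
  unfolding continuous_on_def
proof
  fix z assume z: "z \<in> S"
  let ?b = "norm (B z)" and ?F = "at z within S"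
  have "((\<lambda>y. norm (A y - A z)) \<longlongrightarrow> 0) ?F"
    using A z by (intro tendsto_norm_zero LIM_zero) (auto simp: continuous_on_def)
  then have lim: "((\<lambda>y. norm (A y - A z) * ?b) \<longlongrightarrow> 0) ?F"
    by (rule tendsto_mult_left_zero)
  then have "\<forall>\<^sub>F y in ?F. norm (A y - A z) * ?b < 1 / 2"
    by (rule order_tendstoD) simp
  moreover have "\<forall>\<^sub>F y in ?F. y \<in> S"
    by (simp add: eventually_at_filter)
  ultimately have "\<forall>\<^sub>F y in ?F. norm (B y - B z) \<le> norm (A y - A z) * ?b * (2 * ?b)"
  proof eventually_elim
    case (elim y)
    let ?d = "norm (A y - A z) * ?b"
    have "B y - B z = (B y o\<^sub>L (A z - A y)) o\<^sub>L B z"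
    proof (rule blinfun_eqI)
      fix v
      have "B y (A y (B z v)) = B z v" "A z (B z v) = v"
        using BA[OF elim(2)] AB[OF z] by (metis blinfun_apply_blinfun_compose blinfun_apply_id_blinfun)+
      then show "(B y - B z) v = ((B y o\<^sub>L (A z - A y)) o\<^sub>L B z) v"
        by (simp add: blinfun.diff_left blinfun.diff_right)
    qed
    then have "norm (B y - B z) \<le> norm (B y o\<^sub>L (A z - A y)) * ?b"
      by (simp add: norm_blinfun_compose)
    also have "\<dots> \<le> norm (B y) * norm (A z - A y) * ?b"
      by (intro mult_right_mono norm_blinfun_compose) simp
    also have "\<dots> = norm (B y) * ?d"
      by (simp add: norm_minus_commute)
    finally have le: "norm (B y - B z) \<le> norm (B y) * ?d" .
    have "norm (B y) \<le> norm (B y - B z) + ?b"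
      using norm_triangle_ineq[of "B y - B z" "B z"] by simp
    then have "norm (B y) * ?d \<le> (norm (B y - B z) + ?b) * ?d"
      by (intro mult_right_mono) auto
    also have "\<dots> \<le> norm (B y - B z) * (1 / 2) + ?b * ?d"
      unfolding distrib_right using elim(1) by (intro add_right_mono mult_left_mono) auto
    finally show ?case
      using le by (simp add: algebra_simps)
  qed
  then have "((\<lambda>y. B y - B z) \<longlongrightarrow> 0) ?F"
    by (rule Lim_null_comparison) (use tendsto_mult_left_zero[OF lim] in auto)
  then show "(B \<longlongrightarrow> B z) ?F"
    by (simp add: LIM_zero_iff)
qed

text \<open>The derivatives of the local inverse are the inverses of a continuous family of invertible
  operators, so they depend continuously on the point.\<close>

lemma C1_local_inverse:
  fixes f :: "'a::euclidean_space \<Rightarrow> 'a"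
  assumes "open E" "C1_map_on E f" "p \<in> E" "inj (frechet_derivative f (at p))"
  obtains U V g where "open U" "U \<subseteq> E" "p \<in> U" "open V" "homeomorphism U V f g" "C1_map_on V g"
    "\<And>x. x \<in> U \<Longrightarrow> bij (frechet_derivative f (at x))"
    "\<And>y. y \<in> V \<Longrightarrow> (g has_derivative inv (frechet_derivative f (at (g y)))) (at y)"
proof -
  obtain f' where f': "\<And>x. x \<in> E \<Longrightarrow> (f has_derivative blinfun_apply (f' x)) (at x)"
    and c: "continuous_on E f'"
    using assms(2) by (rule C1_map_onE) blast
  have fd: "frechet_derivative f (at x) = blinfun_apply (f' x)" if "x \<in> E" for x
    using frechet_derivative_at[OF f'[OF that]] by simp
  have injp: "inj (blinfun_apply (f' p))"
    using assms(3,4) fd by simp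
  from injp have inv: "bounded_linear (inv (blinfun_apply (f' p)))"
    by (simp add: inj_linear_imp_inv_bounded_linear blinfun.bounded_linear_right)
  then have "Blinfun (inv (blinfun_apply (f' p))) o\<^sub>L f' p = id_blinfun"
    using injp inv by (intro blinfun_eqI) (simp add: bounded_linear_Blinfun_apply)
  note ift = inverse_function_theorem[OF \<open>open E\<close> f' c \<open>p \<in> E\<close> this]
  obtain U V g g' where U: "open U" "U \<subseteq> E" "p \<in> U" and V: "open V" "f p \<in> V"
    and hom: "homeomorphism U V f g"
    and g': "\<And>y. y \<in> V \<Longrightarrow> (g has_derivative g' y) (at y)"
    and g'_eq: "\<And>y. y \<in> V \<Longrightarrow> g' y = inv (blinfun_apply (f' (g y)))"
    and bij: "\<And>y. y \<in> V \<Longrightarrow> bij (blinfun_apply (f' (g y)))"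
    by (rule ift) (assumption | rule that)+
  have gE: "g y \<in> E" if "y \<in> V" for y
    using homeomorphism_image2[OF hom] U(2) that by blast
  let ?B = "\<lambda>y. Blinfun (g' y)"
  have B: "blinfun_apply (?B y) = g' y" if "y \<in> V" for y
    using g'[OF that] by (simp add: bounded_linear_Blinfun_apply has_derivative_bounded_linear)
  have "continuous_on V ?B"
  proof (rule continuous_on_blinfun_inverse)
    show "continuous_on V (\<lambda>y. f' (g y))"
      using gE by (intro continuous_on_compose2[OF c homeomorphism_cont2[OF hom]]) auto
    show "?B y o\<^sub>L f' (g y) = id_blinfun" "f' (g y) o\<^sub>L ?B y = id_blinfun" if "y \<in> V" for y
      using bij[OF that] B[OF that] g'_eq[OF that]
      by (auto intro!: blinfun_eqI simp: bij_is_inj bij_is_surj surj_f_inv_f)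
  qed
  then have "C1_map_on V g"
    using g' B by (intro C1_map_onI[of V g ?B]) auto
  moreover have "bij (frechet_derivative f (at x))" if "x \<in> U" for x
  proof -
    have "f x \<in> V" "g (f x) = x"
      using hom that by (auto simp: homeomorphism_def)
    then show ?thesis
      using bij[of "f x"] fd U that by auto
  qed
  moreover have "(g has_derivative inv (frechet_derivative f (at (g y)))) (at y)" if "y \<in> V" for y
    using g'[OF that] g'_eq[OF that] fd[OF gE[OF that]] by simp
  ultimately show ?thesis
    using that U V hom by blast
qed

section \<open>Solutions as functions with prescribed derivative along the field\<close>

lemma vector_field_eq_derivative:
  fixes a :: "real^'n \<Rightarrow> real^'n"
  assumes "(\<psi> has_derivative D) (at x)"
  shows "vector_field a \<psi> x = D (a x)"
proof -
  interpret D: bounded_linear D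
    using assms by (rule has_derivative_bounded_linear)
  have "partial k \<psi> x = D (axis k 1)" for k
  proof -
    have "((\<lambda>t. x + t *\<^sub>R axis k 1) has_derivative (\<lambda>t. t *\<^sub>R axis k 1)) (at 0)"
      by (auto intro!: derivative_eq_intros)
    then have "((\<lambda>t. \<psi> (x + t *\<^sub>R axis k 1)) has_derivative (\<lambda>t. D (t *\<^sub>R axis k 1))) (at 0)"
      by (rule has_derivative_compose) (use assms in simp)
    then have "((\<lambda>t. \<psi> (x + t *\<^sub>R axis k 1)) has_field_derivative D (axis k 1)) (at 0)"
      by (simp add: has_field_derivative_def D.scaleR mult_commute_abs)
    then show ?thesis
      unfolding partial_def by (rule DERIV_imp_deriv)
  qed
  then have "vector_field a \<psi> x = D (\<Sum>k\<in>UNIV. (a x $ k) *\<^sub>R axis k 1)"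
    by (simp add: vector_field_def D.sum D.scaleR)
  also have "(\<Sum>k\<in>UNIV. (a x $ k) *\<^sub>R axis k 1) = a x"
    using basis_expansion[of "a x"] by (simp add: scalar_mult_eq_scaleR)
  finally show ?thesis .
qed

lemma solution_on_iff:
  "solution_on S a q \<psi> \<longleftrightarrow>
     C1_map_on S \<psi> \<and> (\<forall>x\<in>S. frechet_derivative \<psi> (at x) (a x) = - q x * \<psi> x)"
proof -
  have "vector_field a \<psi> x = frechet_derivative \<psi> (at x) (a x)"
    if "C1_map_on S \<psi>" "x \<in> S" for x
    using that by (intro vector_field_eq_derivative C1_map_on_has_derivative)
  then show ?thesis
    by (auto simp: solution_on_def C1_on_iff_C1_map_on add_eq_0_iff2)
qed

lemma solution_on_subset: "solution_on T a q \<psi> \<Longrightarrow> S \<subseteq> T \<Longrightarrow> solution_on S a q \<psi>"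
  unfolding solution_on_iff using C1_map_on_subset by blast

lemma solution_on_cong_open:
  assumes "solution_on S a q \<psi>" "open S" "\<And>x. x \<in> S \<Longrightarrow> \<psi> x = \<psi>' x"
  shows "solution_on S a q \<psi>'"
proof -
  have C1: "C1_map_on S \<psi>" and eq: "\<And>x. x \<in> S \<Longrightarrow> frechet_derivative \<psi> (at x) (a x) = - q x * \<psi> x"
    using assms(1) by (auto simp: solution_on_iff)
  have "frechet_derivative \<psi>' (at x) = frechet_derivative \<psi> (at x)" if "x \<in> S" for x
    using has_derivative_transform_within_open[OF C1_map_on_has_derivative[OF C1 that] assms(2) that assms(3)]
    by (rule frechet_derivative_at[symmetric])
  then show ?thesis
    using C1_map_on_cong_open[OF C1 assms(2,3)] eq assms(3) by (simp add: solution_on_iff)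
qed

lemma has_derivative_ratio:
  fixes f g :: "'a::real_normed_vector \<Rightarrow> real"
  assumes "C1_map_on S f" "C1_map_on S g" "x \<in> S" "g x \<noteq> 0"
  shows "((\<lambda>x. f x / g x) has_derivative
    (\<lambda>v. (frechet_derivative f (at x) v * g x - f x * frechet_derivative g (at x) v) / (g x * g x))) (at x)"
  using assms by (intro has_derivative_divide' C1_map_on_has_derivative)

lemma solution_on_ratio:
  assumes "solution_on S a q \<psi>" "solution_on S a q \<eta>" "\<And>x. x \<in> S \<Longrightarrow> \<eta> x \<noteq> 0"
  shows "solution_on S a (\<lambda>_. 0) (\<lambda>x. \<psi> x / \<eta> x)"
proof -
  have C1: "C1_map_on S \<psi>" "C1_map_on S \<eta>"
    using assms by (auto simp: solution_on_iff)
  have "frechet_derivative (\<lambda>x. \<psi> x / \<eta> x) (at x) (a x) = 0" if "x \<in> S" for x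
    using assms that
    by (simp add: solution_on_iff flip: frechet_derivative_at[OF has_derivative_ratio[OF C1 that assms(3)[OF that]]])
  then show ?thesis
    using C1_map_on_divide[OF C1 assms(3)] by (simp add: solution_on_iff)
qed

lemma solution_on_mult:
  assumes "solution_on S a q \<eta>" "solution_on S a (\<lambda>_. 0) \<phi>"
  shows "solution_on S a q (\<lambda>x. \<eta> x * \<phi> x)"
proof -
  have C1: "C1_map_on S \<eta>" "C1_map_on S \<phi>"
    using assms by (auto simp: solution_on_iff)
  have "frechet_derivative (\<lambda>x. \<eta> x * \<phi> x) (at x) (a x) = - q x * (\<eta> x * \<phi> x)" if "x \<in> S" for x
    using assms that
    by (simp add: solution_on_iff
        flip: frechet_derivative_at[OF has_derivative_mult[OF C1(1)[THEN C1_map_on_has_derivative, OF that]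
            C1(2)[THEN C1_map_on_has_derivative, OF that]]])
  then show ?thesis
    using C1_map_on_mult[OF C1] by (simp add: solution_on_iff)
qed

lemma solution_on_compose:
  assumes "C1_map_on S \<Phi>" "\<And>x. x \<in> S \<Longrightarrow> frechet_derivative \<Phi> (at x) (a x) = 0"
    and "C1_function_of S \<Phi> f"
  shows "solution_on S a (\<lambda>_. 0) (\<lambda>x. f (\<Phi> x))"
proof -
  obtain W where W: "\<Phi> ` S \<subseteq> W" "C1_map_on W f"
    using assms(3) by (auto simp: C1_function_of_def C1_on_iff_C1_map_on)
  have "frechet_derivative (\<lambda>x. f (\<Phi> x)) (at x) (a x) = 0" if x: "x \<in> S" for x
  proof -
    let ?f' = "frechet_derivative f (at (\<Phi> x))"
    have "\<Phi> x \<in> W" using W x by blast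
    then have f': "(f has_derivative ?f') (at (\<Phi> x))"
      using W(2) C1_map_on_has_derivative by blast
    show ?thesis
      using assms(2)[OF x] linear_0[OF has_derivative_linear[OF f']]
      by (simp flip: frechet_derivative_at[OF
            has_derivative_compose[OF C1_map_on_has_derivative[OF assms(1) x] f']])
  qed
  then show ?thesis
    using C1_map_on_compose[OF assms(1) W(2,1)] by (simp add: solution_on_iff)
qed

section \<open>Straightening the field\<close>

lemma equal_on_segment:
  fixes k :: "'a::real_normed_vector \<Rightarrow> real"
  assumes "convex B" "C1_map_on B k" "\<And>z. z \<in> B \<Longrightarrow> frechet_derivative k (at z) e = 0"
    and "x \<in> B" "x + c *\<^sub>R e \<in> B"
  shows "k (x + c *\<^sub>R e) = k x"
proof -
  let ?l = "\<lambda>t. x + (t * c) *\<^sub>R e"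
  have l: "?l t \<in> B" if "t \<in> {0..1}" for t
  proof -
    have "?l t = (1 - t) *\<^sub>R x + t *\<^sub>R (x + c *\<^sub>R e)"
      by (simp add: algebra_simps)
    then show ?thesis
      using convexD_alt[OF assms(1,4,5)] that by simp
  qed
  have "((\<lambda>t. k (?l t)) has_derivative (\<lambda>_. 0)) (at t within {0..1})" if t: "t \<in> {0..1}" for t
  proof -
    let ?k' = "frechet_derivative k (at (?l t))"
    have k': "(k has_derivative ?k') (at (?l t))"
      using assms(2) l[OF t] by (rule C1_map_on_has_derivative)
    have "(?l has_derivative (\<lambda>s. (s * c) *\<^sub>R e)) (at t within {0..1})"
      by (auto intro!: derivative_eq_intros)
    from has_derivative_compose[OF this k']
    show ?thesis
      using linear_scale[OF has_derivative_linear[OF k']] assms(3)[OF l[OF t]] by simp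
  qed
  then obtain b where "\<forall>t\<in>{0..1}. k (?l t) = b"
    using has_derivative_zero_constant[of "{0..1}" "\<lambda>t. k (?l t)"] by auto
  from this[rule_format, of 0] this[rule_format, of 1] show ?thesis by simp
qed

text \<open>The image of \<open>\<Psi>\<close> is orthogonal to \<open>e\<close>, so that \<open>F\<close> has \<open>\<Psi>\<close> as its component orthogonal to
  \<open>e\<close> and \<open>\<eta>\<close> as its component along \<open>e\<close>. The neighbourhood \<open>U\<close> is the preimage under \<open>F\<close> of a ball
  about \<open>F p\<close>: the ball is convex, and it is mapped into itself by the projection to the
  hyperplane through \<open>F p\<close> orthogonal to \<open>e\<close>. Hence moving a point along \<open>e\<close> to that hyperplane
  stays in the ball and does not change a solution; this motion is \<open>\<sigma> \<circ> \<Psi>\<close>.\<close>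

lemma local_factorization:
  fixes \<Psi> a :: "real^'n \<Rightarrow> real^'n" and e :: "real^'n" and \<eta> :: "real^'n \<Rightarrow> real"
  defines "F \<equiv> \<lambda>x. \<Psi> x + \<eta> x *\<^sub>R e"
  assumes "open E" and C1_\<Psi>: "C1_map_on E \<Psi>" and C1_\<eta>: "C1_map_on E \<eta>"
    and e: "norm e = 1" and orth: "\<And>x. x \<in> E \<Longrightarrow> \<Psi> x \<bullet> e = 0"
    and inj: "\<And>x. x \<in> E \<Longrightarrow> inj (frechet_derivative F (at x))"
    and ann: "\<And>x. x \<in> E \<Longrightarrow> frechet_derivative \<Psi> (at x) (a x) = 0"
    and nz: "nowhere_locally_zero E a" and p: "p \<in> E" "p \<in> V" and "open V"
  obtains U W \<sigma> where "open U" "p \<in> U" "U \<subseteq> V \<inter> E" "open W" "C1_map_on W \<sigma>"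
    "\<Psi> ` U \<subseteq> W" "\<sigma> ` W \<subseteq> U" "\<And>z. z \<in> W \<Longrightarrow> z \<bullet> e = 0 \<Longrightarrow> \<Psi> (\<sigma> z) = z"
    "\<And>\<phi> x. solution_on U a (\<lambda>_. 0) \<phi> \<Longrightarrow> x \<in> U \<Longrightarrow> \<phi> x = \<phi> (\<sigma> (\<Psi> x))"
proof -
  have ee: "e \<bullet> e = 1"
    using e by (simp add: norm_eq_1)
  have C1_F: "C1_map_on E F"
    unfolding F_def
    by (intro C1_map_on_add C1_\<Psi>
        C1_map_on_compose[OF C1_\<eta> C1_map_on_bounded_linear[OF bounded_linear_scaleR_left] subset_UNIV])
  have F_e: "F x \<bullet> e = \<eta> x" if "x \<in> E" for x
    using orth[OF that] ee by (simp add: F_def inner_add_left)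
  obtain U0 V0 H where U0: "open U0" "U0 \<subseteq> V \<inter> E" "p \<in> U0" and V0: "open V0"
    and hom: "homeomorphism U0 V0 F H" and C1_H: "C1_map_on V0 H"
    and bij: "\<And>x. x \<in> U0 \<Longrightarrow> bij (frechet_derivative F (at x))"
    and H': "\<And>y. y \<in> V0 \<Longrightarrow> (H has_derivative inv (frechet_derivative F (at (H y)))) (at y)"
  proof (rule C1_local_inverse[of "V \<inter> E" F p])
    show "C1_map_on (V \<inter> E) F"
      using C1_F by (rule C1_map_on_subset) simp
  qed (use \<open>open V\<close> \<open>open E\<close> p inj in auto)
  have F_V0: "F x \<in> V0" and HF: "H (F x) = x" if "x \<in> U0" for x
    using hom that by (auto simp: homeomorphism_def)
  have H_U0: "H y \<in> U0" and FH: "F (H y) = y" if "y \<in> V0" for y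
    using hom that unfolding homeomorphism_def by blast+
  obtain r where r: "r > 0" "ball (F p) r \<subseteq> V0"
    using V0 F_V0[OF U0(3)] open_contains_ball by blast
  define B where "B = ball (F p) r"
  have B: "open B" "convex B" "B \<subseteq> V0" "F p \<in> B"
    using r by (auto simp: B_def)
  have open_pre: "open {x \<in> U0. F x \<in> N}" if "open N" for N
  proof -
    have "open (U0 \<inter> F -` N)"
      using homeomorphism_cont1[OF hom] U0(1) that by (rule continuous_open_preimage)
    then show ?thesis by (simp add: Collect_conj_eq vimage_def)
  qed
  define U where "U = {x \<in> U0. F x \<in> B}"
  have U: "open U" "p \<in> U" "U \<subseteq> V \<inter> E"
    using open_pre[OF B(1)] U0 B by (auto simp: U_def)
  have H_U: "H z \<in> U" if "z \<in> B" for z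
    using H_U0 FH B(3) that by (auto simp: U_def)
  define W where "W = {z. z + \<eta> p *\<^sub>R e \<in> B}"
  define \<sigma> where "\<sigma> z = H (z + \<eta> p *\<^sub>R e)" for z
  have "open W"
    unfolding W_def using open_vimage[OF B(1), of "\<lambda>z. z + \<eta> p *\<^sub>R e"]
    by (simp add: vimage_def continuous_intros)
  have C1_\<sigma>: "C1_map_on W \<sigma>"
    unfolding \<sigma>_def
    by (rule C1_map_on_compose[OF C1_map_on_add[OF C1_map_on_bounded_linear[OF bounded_linear_ident] C1_map_on_const] C1_H])
      (use B in \<open>auto simp: W_def\<close>)
  have \<Psi>_W: "\<Psi> x \<in> W" if x: "x \<in> U" for x
  proof -
    have xE: "x \<in> E" using x U by blast
    let ?d = "\<Psi> p - \<Psi> x"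
    have "F p - F x = ?d + (\<eta> p - \<eta> x) *\<^sub>R e"
      by (simp add: F_def algebra_simps)
    moreover have "orthogonal ?d ((\<eta> p - \<eta> x) *\<^sub>R e)"
      using orth[OF xE] orth[OF p(1)] by (simp add: orthogonal_def inner_diff_left)
    ultimately have "(norm (F p - F x))\<^sup>2 = (norm ?d)\<^sup>2 + (norm ((\<eta> p - \<eta> x) *\<^sub>R e))\<^sup>2"
      by (simp add: norm_add_Pythagorean)
    then have "(norm ?d)\<^sup>2 \<le> (norm (F p - F x))\<^sup>2"
      by simp
    then have "norm ?d \<le> norm (F p - F x)"
      by (rule power2_le_imp_le) simp
    also have "\<dots> < r"
      using x by (simp add: U_def B_def dist_norm)
    finally show ?thesis
      by (simp add: W_def B_def dist_norm F_def)
  qed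
  have \<Psi>_\<sigma>: "\<Psi> (\<sigma> z) = z" if "z \<in> W" "z \<bullet> e = 0" for z
  proof -
    let ?x = "\<sigma> z"
    have y: "z + \<eta> p *\<^sub>R e \<in> B"
      using that by (simp add: W_def)
    then have xE: "?x \<in> E" using H_U U by (auto simp: \<sigma>_def)
    have Fx: "F ?x = z + \<eta> p *\<^sub>R e"
      using FH B(3) y by (auto simp: \<sigma>_def)
    then have "\<eta> ?x = \<eta> p"
      using F_e[OF xE] that(2) ee by (simp add: inner_add_left)
    then show ?thesis
      using Fx by (simp add: F_def)
  qed
  have const: "\<phi> x = \<phi> (\<sigma> (\<Psi> x))" if sol: "solution_on U a (\<lambda>_. 0) \<phi>" and x: "x \<in> U" for \<phi> x
  proof -
    define k where "k z = \<phi> (H z)" for z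
    have C1_\<phi>: "C1_map_on U \<phi>" and L\<phi>: "\<And>x. x \<in> U \<Longrightarrow> frechet_derivative \<phi> (at x) (a x) = 0"
      using sol by (auto simp: solution_on_iff)
    have C1_k: "C1_map_on B k"
      unfolding k_def using C1_map_on_subset[OF C1_H B(3)] C1_\<phi> by (rule C1_map_on_compose) (use H_U in auto)
    have zero: "frechet_derivative k (at z) e = 0" if z: "z \<in> B" "a (H z) \<noteq> 0" for z
    proof -
      let ?x = "H z"
      let ?D = "frechet_derivative F (at ?x)" and ?\<phi>' = "frechet_derivative \<phi> (at ?x)"
      have xU: "?x \<in> U" and xE: "?x \<in> E" and xU0: "?x \<in> U0"
        using H_U z U by (auto simp: U_def)
      define c where "c = frechet_derivative \<eta> (at ?x) (a ?x)"
      have "(F has_derivative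
          (\<lambda>v. frechet_derivative \<Psi> (at ?x) v + frechet_derivative \<eta> (at ?x) v *\<^sub>R e)) (at ?x)"
        unfolding F_def
        by (intro has_derivative_add has_derivative_scaleR_left C1_map_on_has_derivative[OF _ xE] C1_\<Psi> C1_\<eta>)
      then have Da: "?D (a ?x) = c *\<^sub>R e"
        using ann[OF xE] by (simp add: c_def flip: frechet_derivative_at)
      have lin: "linear ?D" "linear ?\<phi>'"
        using C1_map_on_has_derivative[OF C1_F xE] C1_map_on_has_derivative[OF C1_\<phi> xU]
        by (auto intro: has_derivative_linear)
      \<comment> \<open>in the new coordinates the field at this point is a nonzero multiple of \<open>e\<close>\<close>
      have "c \<noteq> 0"
        using Da z(2) bij[OF xU0] lin(1) by (auto simp: bij_def linear_injective_0)
      then have "?D ((1 / c) *\<^sub>R a ?x) = e"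
        using Da by (simp add: linear_scale[OF lin(1)])
      then have inv_e: "inv ?D e = (1 / c) *\<^sub>R a ?x"
        using bij[OF xU0] by (metis bij_inv_eq_iff)
      have "z \<in> V0" using z B by blast
      have "frechet_derivative k (at z) e = ?\<phi>' (inv ?D e)"
        unfolding k_def
        by (simp flip: frechet_derivative_at[OF has_derivative_compose[OF H'[OF \<open>z \<in> V0\<close>]
                C1_map_on_has_derivative[OF C1_\<phi> xU]]])
      also have "\<dots> = 0"
        using L\<phi>[OF xU] by (simp add: inv_e linear_scale[OF lin(2)])
      finally show ?thesis .
    qed
    \<comment> \<open>the exceptional points would form a nonempty open set on which \<open>a\<close> vanishes\<close>
    have "frechet_derivative k (at z) e = 0" if z: "z \<in> B" for z
    proof (rule ccontr)
      assume nz_z: "frechet_derivative k (at z) e \<noteq> 0"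
      let ?k' = "\<lambda>z. blinfun_apply (Blinfun (frechet_derivative k (at z))) e"
      have k'_eq: "?k' z = frechet_derivative k (at z) e" if "z \<in> B" for z
        using has_derivative_bounded_linear[OF C1_map_on_has_derivative[OF C1_k that]]
        by (simp add: bounded_linear_Blinfun_apply)
      have "continuous_on B ?k'"
        using C1_map_on_continuous_frechet[OF C1_k] by (intro continuous_intros)
      then have "open (B \<inter> ?k' -` (- {0}))"
        using B(1) by (rule continuous_open_preimage) auto
      then have "open {x \<in> U0. F x \<in> B \<inter> ?k' -` (- {0})}"
        by (rule open_pre)
      moreover have "H z \<in> {x \<in> U0. F x \<in> B \<inter> ?k' -` (- {0})}"
        using z nz_z k'_eq[OF z] B(3) H_U0 FH by auto
      moreover have "{x \<in> U0. F x \<in> B \<inter> ?k' -` (- {0})} \<subseteq> E"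
        using U0 by blast
      ultimately obtain x where x: "x \<in> U0" "F x \<in> B" "?k' (F x) \<noteq> 0" "a x \<noteq> 0"
        using nz unfolding nowhere_locally_zero_def by blast
      then show False
        using zero[of "F x"] HF k'_eq by auto
    qed
    note const_e = equal_on_segment[OF B(2) C1_k this]
    have y: "\<Psi> x + \<eta> p *\<^sub>R e \<in> B"
      using \<Psi>_W[OF x] by (simp add: W_def)
    have Fx: "F x = (\<Psi> x + \<eta> p *\<^sub>R e) + (\<eta> x - \<eta> p) *\<^sub>R e"
      by (simp add: F_def algebra_simps)
    have "k (F x) = k (\<Psi> x + \<eta> p *\<^sub>R e)"
      unfolding Fx by (rule const_e[OF _ y]) (use x Fx in \<open>auto simp: U_def\<close>)
    then show ?thesis
      using HF x by (simp add: k_def \<sigma>_def U_def)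
  qed
  show ?thesis
    by (rule that[OF U \<open>open W\<close> C1_\<sigma>]) (use \<Psi>_W H_U \<Psi>_\<sigma> const in \<open>auto simp: \<sigma>_def W_def\<close>)
qed

text \<open>The situation in which \<open>G \<circ> \<Phi>\<close> and \<open>\<eta>\<close> together are local coordinates. Injectivity
  of \<open>G\<close> is asked for on the values of \<open>\<Phi>\<close> because \<open>G\<close> forgets coordinates that are constant there.\<close>

locale straightened_field =
  fixes E :: "(real^'n) set" and a :: "real^'n \<Rightarrow> real^'n"
    and \<Phi> :: "real^'n \<Rightarrow> real^'m::finite" and \<eta> :: "real^'n \<Rightarrow> real"
    and G :: "real^'m \<Rightarrow> real^'n" and e :: "real^'n"
  assumes open_E: "open E" and C1_\<Phi>: "C1_map_on E \<Phi>" and C1_\<eta>: "C1_map_on E \<eta>"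
    and ann_\<Phi>: "\<And>x. x \<in> E \<Longrightarrow> frechet_derivative \<Phi> (at x) (a x) = 0"
    and nz: "nowhere_locally_zero E a"
    and G: "bounded_linear G" and norm_e: "norm e = 1" and G_e: "\<And>y. G y \<bullet> e = 0"
    and G_inj: "\<And>x x'. x \<in> E \<Longrightarrow> x' \<in> E \<Longrightarrow> G (\<Phi> x) = G (\<Phi> x') \<Longrightarrow> \<Phi> x = \<Phi> x'"
    and inj_F: "\<And>x. x \<in> E \<Longrightarrow> inj (frechet_derivative (\<lambda>x. G (\<Phi> x) + \<eta> x *\<^sub>R e) (at x))"
begin

text \<open>The section depends on \<open>G y\<close> only, so its domain \<open>W\<close> is closed under changing \<open>y\<close> without
  changing \<open>G y\<close>. This gives an open domain although the values of \<open>\<Phi>\<close> itself may lie in a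
  proper subspace.\<close>

lemma local_section:
  assumes "p \<in> E" "p \<in> V" "open V"
  obtains U W \<sigma> where "open U" "p \<in> U" "U \<subseteq> V \<inter> E" "open W" "C1_map_on W \<sigma>"
    "\<And>x. x \<in> U \<Longrightarrow> \<Phi> x \<in> W" "\<And>y. y \<in> W \<Longrightarrow> \<sigma> y \<in> U" "\<And>y. y \<in> W \<Longrightarrow> G (\<Phi> (\<sigma> y)) = G y"
    "\<And>y y'. G y = G y' \<Longrightarrow> y \<in> W \<Longrightarrow> y' \<in> W"
    "\<And>\<phi> x. solution_on U a (\<lambda>_. 0) \<phi> \<Longrightarrow> x \<in> U \<Longrightarrow> \<phi> x = \<phi> (\<sigma> (\<Phi> x))"
proof -
  have ann: "frechet_derivative (\<lambda>x. G (\<Phi> x)) (at x) (a x) = 0" if x: "x \<in> E" for x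
    using ann_\<Phi>[OF x] linear_0[OF bounded_linear.linear[OF G]] by (simp flip: frechet_derivative_at[OF
          bounded_linear.has_derivative[OF G C1_map_on_has_derivative[OF C1_\<Phi> x]]])
  have C1_\<Psi>: "C1_map_on E (\<lambda>x. G (\<Phi> x))"
    using C1_\<Phi> C1_map_on_bounded_linear[OF G] subset_UNIV by (rule C1_map_on_compose)
  obtain U W \<sigma> where U: "open U" "p \<in> U" "U \<subseteq> V \<inter> E" and W: "open W" and C1_\<sigma>: "C1_map_on W \<sigma>"
    and UW: "(\<lambda>x. G (\<Phi> x)) ` U \<subseteq> W" and \<sigma>U: "\<sigma> ` W \<subseteq> U"
    and sec: "\<And>z. z \<in> W \<Longrightarrow> z \<bullet> e = 0 \<Longrightarrow> G (\<Phi> (\<sigma> z)) = z"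
    and fac: "\<And>\<phi> x. solution_on U a (\<lambda>_. 0) \<phi> \<Longrightarrow> x \<in> U \<Longrightarrow> \<phi> x = \<phi> (\<sigma> (G (\<Phi> x)))"
    by (rule local_factorization[OF open_E C1_\<Psi> C1_\<eta> norm_e G_e inj_F ann nz assms])
      (assumption | rule that)+
  show ?thesis
  proof (rule that[OF U])
    show "open (G -` W)"
      using W linear_continuous_on[OF G] by (rule open_vimage)
    show "C1_map_on (G -` W) (\<lambda>y. \<sigma> (G y))"
      using C1_map_on_bounded_linear[OF G] C1_\<sigma> by (rule C1_map_on_compose) auto
    show "\<phi> x = \<phi> (\<sigma> (G (\<Phi> x)))" if "solution_on U a (\<lambda>_. 0) \<phi>" "x \<in> U" for \<phi> x
      using that by (rule fac)
  qed (use UW \<sigma>U sec G_e in auto)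
qed

lemma solutions_factor_locally:
  assumes "p \<in> E" "p \<in> V" "open V"
  obtains U where "open U" "p \<in> U" "U \<subseteq> V \<inter> E"
    "\<And>\<phi>. solution_on U a (\<lambda>_. 0) \<phi> \<Longrightarrow> \<exists>f. C1_function_of U \<Phi> f \<and> (\<forall>x\<in>U. \<phi> x = f (\<Phi> x))"
proof -
  obtain U W \<sigma> where U: "open U" "p \<in> U" "U \<subseteq> V \<inter> E" and W: "open W" and C1_\<sigma>: "C1_map_on W \<sigma>"
    and \<Phi>W: "\<And>x. x \<in> U \<Longrightarrow> \<Phi> x \<in> W" and \<sigma>U: "\<And>y. y \<in> W \<Longrightarrow> \<sigma> y \<in> U"
    and fac: "\<And>\<phi> x. solution_on U a (\<lambda>_. 0) \<phi> \<Longrightarrow> x \<in> U \<Longrightarrow> \<phi> x = \<phi> (\<sigma> (\<Phi> x))"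
    by (rule local_section[OF assms]) (assumption | rule that)+
  have "\<exists>f. C1_function_of U \<Phi> f \<and> (\<forall>x\<in>U. \<phi> x = f (\<Phi> x))" if sol: "solution_on U a (\<lambda>_. 0) \<phi>" for \<phi>
  proof (intro exI conjI ballI)
    have "C1_map_on W (\<lambda>y. \<phi> (\<sigma> y))"
      using sol \<sigma>U by (intro C1_map_on_compose[OF C1_\<sigma>]) (auto simp: solution_on_iff)
    then show "C1_function_of U \<Phi> (\<lambda>y. \<phi> (\<sigma> y))"
      using W \<Phi>W by (auto simp: C1_function_of_def C1_on_iff_C1_map_on)
    show "\<phi> x = \<phi> (\<sigma> (\<Phi> x))" if "x \<in> U" for x
      using sol that by (rule fac)
  qed
  then show ?thesis
    using that U by blast
qed

text \<open>The local factorization makes \<open>\<phi>\<close> locally constant on the level set.\<close>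

lemma solution_constant_on_level_sets:
  assumes conn: "connected_level_sets E \<Phi>" and sol: "solution_on E a (\<lambda>_. 0) \<phi>"
    and x: "x \<in> E" "x' \<in> E" "\<Phi> x = \<Phi> x'"
  shows "\<phi> x = \<phi> x'"
proof -
  let ?L = "{z \<in> E. \<Phi> z = \<Phi> x}"
  have "\<phi> constant_on ?L"
  proof (rule locally_constant_imp_constant)
    show "connected ?L"
      using conn by (simp add: connected_level_sets_def)
    fix p assume p: "p \<in> ?L"
    then have pE: "p \<in> E" by simp
    obtain U \<sigma> where U: "open U" "p \<in> U" "U \<subseteq> UNIV \<inter> E"
      and fac: "\<And>\<phi> x. solution_on U a (\<lambda>_. 0) \<phi> \<Longrightarrow> x \<in> U \<Longrightarrow> \<phi> x = \<phi> (\<sigma> (\<Phi> x))"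
      by (rule local_section[OF pE UNIV_I open_UNIV]) (assumption | rule that)+
    have "solution_on U a (\<lambda>_. 0) \<phi>"
      using sol U(3) by (auto intro: solution_on_subset)
    note \<phi>_eq = fac[OF this]
    show "\<exists>T. openin (top_of_set ?L) T \<and> p \<in> T \<and> (\<forall>z\<in>T. \<phi> z = \<phi> p)"
    proof (intro exI conjI ballI)
      show "openin (top_of_set ?L) (?L \<inter> U)"
        using U(1) by (rule openin_open_Int)
      show "p \<in> ?L \<inter> U"
        using p U by simp
      show "\<phi> z = \<phi> p" if "z \<in> ?L \<inter> U" for z
        using that p U(2) \<phi>_eq[of z] \<phi>_eq[of p] by simp
    qed
  qed
  then show ?thesis
    using x by (auto simp: constant_on_def)
qed

lemma solution_factors_globally:
  assumes conn: "connected_level_sets E \<Phi>" and sol: "solution_on E a (\<lambda>_. 0) \<phi>"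
  shows "\<exists>f. C1_function_of E \<Phi> f \<and> (\<forall>x\<in>E. \<phi> x = f (\<Phi> x))"
proof -
  \<comment> \<open>comparing \<open>G y\<close> rather than \<open>y\<close> extends \<open>f\<close> from the values of \<open>\<Phi>\<close> to an open set\<close>
  define f where "f y = \<phi> (SOME x. x \<in> E \<and> G (\<Phi> x) = G y)" for y
  have f_eq: "f y = \<phi> x" if x: "x \<in> E" "G (\<Phi> x) = G y" for x y
  proof -
    have "\<exists>x. x \<in> E \<and> G (\<Phi> x) = G y"
      using x by (intro exI[of _ x]) simp
    from someI_ex[OF this] show ?thesis
      unfolding f_def
      using x by (intro solution_constant_on_level_sets[OF conn sol] G_inj) auto
  qed
  define \<Omega> where "\<Omega> = {y. \<exists>x\<in>E. G (\<Phi> x) = G y}"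
  have nbhd: "\<exists>W. open W \<and> y \<in> W \<and> W \<subseteq> \<Omega> \<and> C1_map_on W f" if y: "y \<in> \<Omega>" for y
  proof -
    obtain p where p: "p \<in> E" "G (\<Phi> p) = G y"
      using y by (auto simp: \<Omega>_def)
    obtain U W \<sigma> where U: "open U" "p \<in> U" "U \<subseteq> UNIV \<inter> E" and W: "open W" and C1_\<sigma>: "C1_map_on W \<sigma>"
      and \<Phi>W: "\<And>x. x \<in> U \<Longrightarrow> \<Phi> x \<in> W" and \<sigma>U: "\<And>y. y \<in> W \<Longrightarrow> \<sigma> y \<in> U"
      and sec: "\<And>y. y \<in> W \<Longrightarrow> G (\<Phi> (\<sigma> y)) = G y"
      and W_G: "\<And>y y'. G y = G y' \<Longrightarrow> y \<in> W \<Longrightarrow> y' \<in> W"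
      by (rule local_section[OF p(1) UNIV_I open_UNIV]) (assumption | rule that)+
    have \<sigma>E: "\<sigma> z \<in> E" if "z \<in> W" for z
      using \<sigma>U[OF that] U by blast
    have "C1_map_on W (\<lambda>z. \<phi> (\<sigma> z))"
      using sol \<sigma>E by (intro C1_map_on_compose[OF C1_\<sigma>]) (auto simp: solution_on_iff)
    then have "C1_map_on W f"
      by (rule C1_map_on_cong_open[OF _ W]) (simp add: f_eq[OF \<sigma>E sec])
    moreover have "y \<in> W"
      using W_G[OF p(2)] \<Phi>W[OF U(2)] by simp
    moreover have "W \<subseteq> \<Omega>"
      using \<sigma>E sec by (auto simp: \<Omega>_def)
    ultimately show ?thesis
      using W by blast
  qed
  have "open \<Omega>"
    by (subst open_subopen) (blast dest: nbhd)
  moreover have "C1_map_on \<Omega> f"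
    by (rule C1_map_on_locally) (drule nbhd, blast)
  moreover have "\<Phi> ` E \<subseteq> \<Omega>"
    by (auto simp: \<Omega>_def)
  ultimately have "C1_function_of E \<Phi> f"
    by (auto simp: C1_function_of_def C1_on_iff_C1_map_on)
  then show ?thesis
    using f_eq[OF _ refl] by (intro exI[of _ f]) simp
qed

end

section \<open>General solutions\<close>

lemma general_solution_on_homogeneousI:
  assumes "open U" "C1_map_on U \<Phi>" "\<And>x. x \<in> U \<Longrightarrow> frechet_derivative \<Phi> (at x) (a x) = 0"
    and "\<And>\<phi>. solution_on U a (\<lambda>_. 0) \<phi> \<Longrightarrow> \<exists>f. C1_function_of U \<Phi> f \<and> (\<forall>x\<in>U. \<phi> x = f (\<Phi> x))"
  shows "general_solution_on U a (\<lambda>_. 0) \<Phi> (\<lambda>f x. f (\<Phi> x))"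
  unfolding general_solution_on_def
proof (intro allI iffI)
  fix \<psi> assume "\<exists>f. C1_function_of U \<Phi> f \<and> (\<forall>x\<in>U. \<psi> x = f (\<Phi> x))"
  then obtain f where f: "C1_function_of U \<Phi> f" "\<And>x. x \<in> U \<Longrightarrow> f (\<Phi> x) = \<psi> x"
    by auto
  show "solution_on U a (\<lambda>_. 0) \<psi>"
    by (rule solution_on_cong_open[OF solution_on_compose[OF assms(2,3) f(1)] assms(1) f(2)])
qed (rule assms(4))

lemma general_solution_on_inhomogeneous:
  assumes gen: "general_solution_on U a (\<lambda>_. 0) \<Phi> (\<lambda>f x. f (\<Phi> x))"
    and "open U" and \<eta>: "solution_on U a q \<eta>" "\<And>x. x \<in> U \<Longrightarrow> \<eta> x \<noteq> 0"
  shows "general_solution_on U a q \<Phi> (\<lambda>f x. \<eta> x * f (\<Phi> x))"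
proof -
  have hom: "solution_on U a (\<lambda>_. 0) \<phi> \<longleftrightarrow>
      (\<exists>f. C1_function_of U \<Phi> f \<and> (\<forall>x\<in>U. \<phi> x = f (\<Phi> x)))" for \<phi>
    using gen by (simp add: general_solution_on_def)
  show ?thesis
    unfolding general_solution_on_def
  proof (intro allI iffI)
    fix \<psi> assume "solution_on U a q \<psi>"
    then have "solution_on U a (\<lambda>_. 0) (\<lambda>x. \<psi> x / \<eta> x)"
      using \<eta> by (rule solution_on_ratio)
    then obtain f where "C1_function_of U \<Phi> f" "\<And>x. x \<in> U \<Longrightarrow> \<psi> x / \<eta> x = f (\<Phi> x)"
      unfolding hom by blast
    then show "\<exists>f. C1_function_of U \<Phi> f \<and> (\<forall>x\<in>U. \<psi> x = \<eta> x * f (\<Phi> x))"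
      using \<eta>(2) by (intro exI[of _ f]) (auto simp: divide_eq_eq mult.commute)
  next
    fix \<psi> assume "\<exists>f. C1_function_of U \<Phi> f \<and> (\<forall>x\<in>U. \<psi> x = \<eta> x * f (\<Phi> x))"
    then obtain f where f: "C1_function_of U \<Phi> f" "\<And>x. x \<in> U \<Longrightarrow> \<eta> x * f (\<Phi> x) = \<psi> x"
      by auto
    have "solution_on U a (\<lambda>_. 0) (\<lambda>x. f (\<Phi> x))"
      unfolding hom using f(1) by blast
    from solution_on_mult[OF \<eta>(1) this] \<open>open U\<close> f(2) show "solution_on U a q \<psi>"
      by (rule solution_on_cong_open)
  qed
qed

section \<open>The coordinates given by the ratios and the denominator\<close>

lemma sum_option:
  fixes h :: "'i option \<Rightarrow> 'b::comm_monoid_add"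
  shows "finite J \<Longrightarrow> (\<Sum>i\<in>insert None (Some ` J). h i) = h None + (\<Sum>j\<in>J. h (Some j))"
  by (subst sum.insert) (auto simp: sum.reindex)

text \<open>A relation with coefficients \<open>c\<close> between the differentials of \<open>\<eta>\<close> and \<open>\<eta>\<^sub>j / \<eta>\<close> becomes, by
  the quotient rule, a relation between those of \<open>\<eta>\<close> and \<open>\<eta>\<^sub>j\<close>, with the coefficients \<open>d\<close> below;
  \<open>d\<close> vanishes only if \<open>c\<close> does.\<close>

lemma functionally_independent_ratios:
  fixes \<eta> :: "'a::real_normed_vector \<Rightarrow> real"
  assumes "finite J" and C1: "C1_map_on S \<eta>" "\<And>j. j \<in> J \<Longrightarrow> C1_map_on S (\<eta>s j)"
    and ind: "functionally_independent_on S (insert None (Some ` J)) (case_option \<eta> \<eta>s)"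
    and nz: "\<And>x. x \<in> S \<Longrightarrow> \<eta> x \<noteq> 0"
  shows "functionally_independent_on S (insert None (Some ` J)) (case_option \<eta> (\<lambda>j x. \<eta>s j x / \<eta> x))"
  unfolding functionally_independent_on_def
proof (intro ballI allI impI)
  fix x and c :: "'b option \<Rightarrow> real" and i
  assume x: "x \<in> S" and i: "i \<in> insert None (Some ` J)"
    and zero: "\<forall>v. (\<Sum>i\<in>insert None (Some ` J).
      c i * frechet_derivative (case_option \<eta> (\<lambda>j x. \<eta>s j x / \<eta> x) i) (at x) v) = 0"
  let ?d = "\<lambda>f. frechet_derivative f (at x)"
  define d where "d = case_option (c None - (\<Sum>j\<in>J. c (Some j) * \<eta>s j x / (\<eta> x * \<eta> x)))
    (\<lambda>j. c (Some j) / \<eta> x)"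
  have ratio: "?d (\<lambda>x. \<eta>s j x / \<eta> x) v = ?d (\<eta>s j) v / \<eta> x - \<eta>s j x / (\<eta> x * \<eta> x) * ?d \<eta> v"
    if "j \<in> J" for j v
    using nz[OF x] by (simp add: diff_divide_distrib
        flip: frechet_derivative_at[OF has_derivative_ratio[OF C1(2)[OF that] C1(1) x nz[OF x]]])
  have "(\<Sum>i\<in>insert None (Some ` J). d i * ?d (case_option \<eta> \<eta>s i) v) = 0" for v
  proof -
    have "(\<Sum>i\<in>insert None (Some ` J). d i * ?d (case_option \<eta> \<eta>s i) v)
        = c None * ?d \<eta> v - (\<Sum>j\<in>J. c (Some j) * \<eta>s j x / (\<eta> x * \<eta> x)) * ?d \<eta> v
          + (\<Sum>j\<in>J. c (Some j) / \<eta> x * ?d (\<eta>s j) v)"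
      unfolding sum_option[OF \<open>finite J\<close>] by (simp add: d_def left_diff_distrib)
    also have "\<dots> = c None * ?d \<eta> v + (\<Sum>j\<in>J. c (Some j) * ?d (\<lambda>x. \<eta>s j x / \<eta> x) v)"
      by (simp add: ratio sum_distrib_right right_diff_distrib sum_subtractf mult.assoc)
    also have "\<dots> = 0"
      using zero[rule_format, of v] unfolding sum_option[OF \<open>finite J\<close>] by simp
    finally show ?thesis .
  qed
  then have d0: "\<forall>i\<in>insert None (Some ` J). d i = 0"
    using ind x unfolding functionally_independent_on_def by blast
  then have cJ: "c (Some j) = 0" if "j \<in> J" for j
    using nz[OF x] that by (auto simp: d_def)
  moreover have "c None = 0"
    using d0 cJ by (simp add: d_def)
  ultimately show "c i = 0"
    using i by auto
qed

text \<open>The differentials are the rows of the Jacobian matrix, which is square.\<close>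

lemma inj_derivative_of_independent:
  fixes g :: "'i \<Rightarrow> real^'n \<Rightarrow> real" and b :: "'n \<Rightarrow> 'i"
  assumes b: "bij_betw b UNIV I" and C1: "\<And>i. i \<in> I \<Longrightarrow> C1_map_on S (g i)"
    and ind: "functionally_independent_on S I g" and x: "x \<in> S"
  shows "inj (frechet_derivative (\<lambda>x. \<chi> k. g (b k) x) (at x))"
proof -
  let ?F = "\<lambda>x. \<chi> k. g (b k) x"
  define D where "D = frechet_derivative ?F (at x)"
  have bI: "b k \<in> I" for k
    using b by (auto simp: bij_betw_def)
  have "C1_map_on S ?F"
    by (rule C1_map_on_componentwise) (simp add: C1 bI)
  from C1_map_on_has_derivative[OF this x] have D: "(?F has_derivative D) (at x)"
    by (simp add: D_def)
  then have lin: "linear D"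
    by (rule has_derivative_linear)
  have matrix_D: "matrix D *v v = D v" for v
    using lin by simp
  have D_comp: "D v $ k = frechet_derivative (g (b k)) (at x) v" for v k
    using fun_cong[OF frechet_derivative_at[OF bounded_linear.has_derivative[OF bounded_linear_vec_nth D, of k]], of v]
    by simp
  have "\<exists>B. matrix D ** B = mat 1"
    unfolding matrix_right_invertible_independent_rows
  proof (intro allI impI)
    fix c k assume c: "(\<Sum>k\<in>UNIV. c k *s row k (matrix D)) = 0"
    define d where "d i = c (inv_into UNIV b i)" for i
    have db: "d (b k) = c k" for k
      using b by (simp add: d_def bij_betw_def)
    have "(\<Sum>i\<in>I. d i * frechet_derivative (g i) (at x) v) = 0" for v
    proof -
      have "(\<Sum>i\<in>I. d i * frechet_derivative (g i) (at x) v)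
          = (\<Sum>k\<in>UNIV. c k * (D v $ k))"
        by (simp add: sum.reindex_bij_betw[OF b, symmetric] db D_comp)
      also have "\<dots> = (\<Sum>k\<in>UNIV. c k * (row k (matrix D) \<bullet> v))"
        by (simp add: matrix_vector_mul_component row_def flip: matrix_D)
      also have "\<dots> = (\<Sum>k\<in>UNIV. c k *s row k (matrix D)) \<bullet> v"
        by (simp add: inner_sum_left scalar_mult_eq_scaleR)
      finally show ?thesis
        using c by simp
    qed
    then have "\<forall>i\<in>I. d i = 0"
      using ind x unfolding functionally_independent_on_def by blast
    then show "c k = 0"
      using db bI by metis
  qed
  then have "\<exists>B. B ** matrix D = mat 1"
    using matrix_left_right_inverse by blast
  then have "inj ((*v) (matrix D))"
    by (simp add: matrix_left_invertible_injective)
  then show ?thesis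
    using lin by (simp add: D_def[symmetric] matrix_D inj_def)
qed

theorem mainTheorem11:
  fixes E :: "(real^'n) set"
    and a :: "real^'n \<Rightarrow> real^'n"
    and q \<eta> :: "real^'n \<Rightarrow> real"
    and J :: "'m::finite set"
    and \<eta>s :: "'m \<Rightarrow> real^'n \<Rightarrow> real"
  defines "\<Phi> \<equiv> ratios J \<eta> \<eta>s"
  assumes "open E" and "continuous_on E a" and "continuous_on E q"
    and "card J + 1 = CARD('n)"
    and "solution_on E a q \<eta>" and "\<forall>j\<in>J. solution_on E a q (\<eta>s j)"
    and "functionally_independent_on E (insert None (Some ` J)) (case_option \<eta> \<eta>s)"
    and "\<forall>x\<in>E. \<eta> x \<noteq> 0"
  shows
    "((\<forall>j\<in>J. solution_on E a (\<lambda>_. 0) (\<lambda>x. \<eta>s j x / \<eta> x)) \<and>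
      functionally_independent_on E J (\<lambda>j x. \<eta>s j x / \<eta> x))
   \<and>
     ((\<forall>f. C1_function_of E \<Phi> f \<longrightarrow>
         solution_on E a (\<lambda>_. 0) (\<lambda>x. f (\<Phi> x)) \<and> solution_on E a q (\<lambda>x. \<eta> x * f (\<Phi> x))) \<and>
      (nowhere_locally_zero E a \<longrightarrow>
         locally_on E (\<lambda>U. general_solution_on U a (\<lambda>_. 0) \<Phi> (\<lambda>f x. f (\<Phi> x)) \<and>
                           general_solution_on U a q \<Phi> (\<lambda>f x. \<eta> x * f (\<Phi> x))) \<and>
         (connected_level_sets E \<Phi> \<longrightarrow>
            general_solution_on E a (\<lambda>_. 0) \<Phi> (\<lambda>f x. f (\<Phi> x)) \<and>
            general_solution_on E a q \<Phi> (\<lambda>f x. \<eta> x * f (\<Phi> x)))))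
   \<and>
     (nowhere_locally_zero E a \<longrightarrow>
       (\<forall>\<eta>n. solution_on E a q \<eta>n \<longrightarrow>
         locally_on E (\<lambda>U. \<exists>f\<^sub>0. C1_function_of U \<Phi> f\<^sub>0 \<and> (\<forall>x\<in>U. \<eta>n x / \<eta> x = f\<^sub>0 (\<Phi> x))) \<and>
         (connected_level_sets E \<Phi> \<longrightarrow>
            (\<exists>f\<^sub>0. C1_function_of E \<Phi> f\<^sub>0 \<and> (\<forall>x\<in>E. \<eta>n x / \<eta> x = f\<^sub>0 (\<Phi> x))))))"
proof -
  define \<phi>s where "\<phi>s j x = \<eta>s j x / \<eta> x" for j x
  note nonzero = assms(9)[rule_format]
  have C1_\<eta>s: "C1_map_on E (\<eta>s j)" if "j \<in> J" for j
    using assms(7) that by (auto simp: solution_on_iff)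
  have C1_\<eta>: "C1_map_on E \<eta>"
    using assms(6) by (simp add: solution_on_iff)
  have sol_\<phi>s: "solution_on E a (\<lambda>_. 0) (\<phi>s j)" if "j \<in> J" for j
    unfolding \<phi>s_def using assms(7) that by (intro solution_on_ratio[OF _ assms(6) nonzero]) auto
  have C1_\<phi>s: "C1_map_on E (\<phi>s j)" if "j \<in> J" for j
    using sol_\<phi>s[OF that] by (simp add: solution_on_iff)
  have ind: "functionally_independent_on E (insert None (Some ` J)) (case_option \<eta> \<phi>s)"
    using functionally_independent_ratios[OF finite C1_\<eta> C1_\<eta>s assms(8) nonzero]
    by (simp add: \<phi>s_def[abs_def])
  have ind_\<phi>s: "functionally_independent_on E J \<phi>s"
    unfolding functionally_independent_on_def
  proof (intro ballI allI impI)
    fix x c j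
    assume x: "x \<in> E" and j: "j \<in> J"
      and zero: "\<forall>v. (\<Sum>j\<in>J. c j * frechet_derivative (\<phi>s j) (at x) v) = 0"
    have "\<forall>v. (\<Sum>i\<in>insert None (Some ` J).
        case_option 0 c i * frechet_derivative (case_option \<eta> \<phi>s i) (at x) v) = 0"
      unfolding sum_option[OF finite[of J]] using zero by simp
    then have "\<forall>i\<in>insert None (Some ` J). case_option 0 c i = 0"
      using ind x unfolding functionally_independent_on_def by blast
    then show "c j = 0"
      using j by auto
  qed
  have \<Phi>_comp: "\<Phi> x $ j = (if j \<in> J then \<phi>s j x else 0)" for x j
    by (simp add: \<Phi>_def ratios_def \<phi>s_def)
  have "C1_map_on E (\<lambda>x. \<Phi> x $ j)" for j
    by (cases "j \<in> J") (simp_all add: \<Phi>_comp C1_\<phi>s C1_map_on_const)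
  then have C1_\<Phi>: "C1_map_on E \<Phi>"
    by (rule C1_map_on_componentwise)
  have ann_\<Phi>: "frechet_derivative \<Phi> (at x) (a x) = 0" if x: "x \<in> E" for x
  proof -
    have "frechet_derivative \<Phi> (at x) (a x) $ j = 0" for j
    proof -
      have "frechet_derivative \<Phi> (at x) (a x) $ j = frechet_derivative (\<lambda>x. \<Phi> x $ j) (at x) (a x)"
        using fun_cong[OF frechet_derivative_at[OF bounded_linear.has_derivative[OF
              bounded_linear_vec_nth C1_map_on_has_derivative[OF C1_\<Phi> x], of j]], of "a x"] by simp
      also have "\<dots> = 0"
        using sol_\<phi>s[of j] x by (cases "j \<in> J") (auto simp: \<Phi>_comp solution_on_iff)
      finally show ?thesis .
    qed
    then show ?thesis
      by (simp add: vec_eq_iff)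
  qed
  \<comment> \<open>the bijection \<open>b\<close> assigns to the \<open>n\<close> coordinates the \<open>n - 1\<close> ratios and, at \<open>k0\<close>, the denominator\<close>
  have "card (insert None (Some ` J)) = CARD('n)"
    using assms(5) by (simp add: card_image)
  then obtain b :: "'n \<Rightarrow> 'm option" where b: "bij_betw b UNIV (insert None (Some ` J))"
    using finite_same_card_bij[of "UNIV :: 'n set" "insert None (Some ` J)"] by auto
  then have range_b: "range b = insert None (Some ` J)"
    by (rule bij_betw_imp_surj_on)
  then have "None \<in> range b"
    by simp
  then obtain k0 where k0: "b k0 = None"
    by (metis rangeE)
  have b_None: "b k = None \<longleftrightarrow> k = k0" for k
    using b k0 by (metis UNIV_I bij_betw_def inj_on_def)
  have b_J: "\<exists>k. b k = Some j" if "j \<in> J" for j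
  proof -
    have "Some j \<in> range b"
      using range_b that by simp
    then show ?thesis
      by (metis rangeE)
  qed
  have J_b: "j \<in> J" if "b k = Some j" for j k
  proof -
    have "b k \<in> insert None (Some ` J)"
      using range_b by blast
    then show ?thesis
      using that by auto
  qed
  define G :: "real^'m \<Rightarrow> real^'n"
    where "G y = (\<chi> k. case b k of None \<Rightarrow> 0 | Some j \<Rightarrow> y $ j)" for y
  define e :: "real^'n" where "e = axis k0 1"
  have chart: "G (\<Phi> x) + \<eta> x *\<^sub>R e = (\<chi> k. case_option \<eta> \<phi>s (b k) x)" for x
    by (auto simp: vec_eq_iff G_def e_def axis_def k0 \<Phi>_comp b_None J_b split: option.split)
  have straightened: "straightened_field E a \<Phi> \<eta> G e" if nz: "nowhere_locally_zero E a"
  proof (rule straightened_field.intro)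
    show "bounded_linear G"
      unfolding G_def linear_conv_bounded_linear[symmetric]
      by (rule linearI) (auto simp: vec_eq_iff split: option.split)
    show "norm e = 1"
      by (simp add: e_def)
    show "G y \<bullet> e = 0" for y
      by (simp add: e_def inner_axis G_def k0)
    show "\<Phi> x = \<Phi> x'" if "G (\<Phi> x) = G (\<Phi> x')" for x x'
    proof -
      have "\<Phi> x $ j = \<Phi> x' $ j" if "j \<in> J" for j
      proof -
        obtain k where "b k = Some j"
          using b_J \<open>j \<in> J\<close> by blast
        then show ?thesis
          using arg_cong[OF \<open>G (\<Phi> x) = G (\<Phi> x')\<close>, of "\<lambda>z. z $ k"] by (simp add: G_def)
      qed
      then show ?thesis
        by (auto simp: vec_eq_iff \<Phi>_comp)
    qed
    show "inj (frechet_derivative (\<lambda>x. G (\<Phi> x) + \<eta> x *\<^sub>R e) (at x))" if "x \<in> E" for x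
      unfolding chart
      by (rule inj_derivative_of_independent[OF b _ ind that]) (auto simp: C1_\<eta> C1_\<phi>s)
  qed (use assms(2) C1_\<Phi> C1_\<eta> ann_\<Phi> nz in auto)
  have f_sol: "solution_on E a (\<lambda>_. 0) (\<lambda>x. f (\<Phi> x))" if "C1_function_of E \<Phi> f" for f
    using that by (intro solution_on_compose[OF C1_\<Phi> ann_\<Phi>])
  have general: "general_solution_on U a (\<lambda>_. 0) \<Phi> (\<lambda>f x. f (\<Phi> x)) \<and>
      general_solution_on U a q \<Phi> (\<lambda>f x. \<eta> x * f (\<Phi> x))"
    if U: "open U" "U \<subseteq> E"
      and fac: "\<And>\<phi>. solution_on U a (\<lambda>_. 0) \<phi> \<Longrightarrow>
        \<exists>f. C1_function_of U \<Phi> f \<and> (\<forall>x\<in>U. \<phi> x = f (\<Phi> x))" for U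
  proof (rule context_conjI)
    show "general_solution_on U a (\<lambda>_. 0) \<Phi> (\<lambda>f x. f (\<Phi> x))"
      using U ann_\<Phi> by (intro general_solution_on_homogeneousI C1_map_on_subset[OF C1_\<Phi>] fac) auto
    then show "general_solution_on U a q \<Phi> (\<lambda>f x. \<eta> x * f (\<Phi> x))"
      using U nonzero
      by (intro general_solution_on_inhomogeneous solution_on_subset[OF assms(6)]) auto
  qed
  have local: "locally_on E (\<lambda>U. general_solution_on U a (\<lambda>_. 0) \<Phi> (\<lambda>f x. f (\<Phi> x)) \<and>
      general_solution_on U a q \<Phi> (\<lambda>f x. \<eta> x * f (\<Phi> x)))" if nz: "nowhere_locally_zero E a"
    unfolding locally_on_def
  proof (intro ballI allI impI)
    fix p V assume p: "p \<in> E" and V: "open V \<and> p \<in> V"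
    obtain U where U: "open U" "p \<in> U" "U \<subseteq> V \<inter> E"
      and fac: "\<And>\<phi>. solution_on U a (\<lambda>_. 0) \<phi> \<Longrightarrow>
        \<exists>f. C1_function_of U \<Phi> f \<and> (\<forall>x\<in>U. \<phi> x = f (\<Phi> x))"
      by (rule straightened_field.solutions_factor_locally[OF straightened[OF nz] p, of V])
        (use V in auto)
    then show "\<exists>U. open U \<and> p \<in> U \<and> U \<subseteq> V \<inter> E \<and>
        general_solution_on U a (\<lambda>_. 0) \<Phi> (\<lambda>f x. f (\<Phi> x)) \<and>
        general_solution_on U a q \<Phi> (\<lambda>f x. \<eta> x * f (\<Phi> x))"
      using general[of U] by auto
  qed
  have global: "general_solution_on E a (\<lambda>_. 0) \<Phi> (\<lambda>f x. f (\<Phi> x)) \<and>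
      general_solution_on E a q \<Phi> (\<lambda>f x. \<eta> x * f (\<Phi> x))"
    if "nowhere_locally_zero E a" "connected_level_sets E \<Phi>"
    using straightened_field.solution_factors_globally[OF straightened] that assms(2)
    by (intro general) auto
  have ratio_form: "\<exists>f. C1_function_of U \<Phi> f \<and> (\<forall>x\<in>U. \<eta>n x / \<eta> x = f (\<Phi> x))"
    if "solution_on E a q \<eta>n" "U \<subseteq> E" "general_solution_on U a (\<lambda>_. 0) \<Phi> (\<lambda>f x. f (\<Phi> x))"
    for U \<eta>n
  proof -
    have "solution_on U a (\<lambda>_. 0) (\<lambda>x. \<eta>n x / \<eta> x)"
      using that(1,2) by (intro solution_on_subset[OF solution_on_ratio[OF _ assms(6) nonzero]])
    then show ?thesis
      using that(3) by (simp add: general_solution_on_def)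
  qed
  have third: "locally_on E (\<lambda>U. \<exists>f\<^sub>0. C1_function_of U \<Phi> f\<^sub>0 \<and> (\<forall>x\<in>U. \<eta>n x / \<eta> x = f\<^sub>0 (\<Phi> x)))"
    if nz: "nowhere_locally_zero E a" and sol: "solution_on E a q \<eta>n" for \<eta>n
    unfolding locally_on_def
  proof (intro ballI allI impI)
    fix p V assume "p \<in> E" "open V \<and> p \<in> V"
    then obtain U where "open U" "p \<in> U" "U \<subseteq> V \<inter> E"
      "general_solution_on U a (\<lambda>_. 0) \<Phi> (\<lambda>f x. f (\<Phi> x))"
      using local[OF nz] unfolding locally_on_def by blast
    then show "\<exists>U. open U \<and> p \<in> U \<and> U \<subseteq> V \<inter> E \<and>
        (\<exists>f\<^sub>0. C1_function_of U \<Phi> f\<^sub>0 \<and> (\<forall>x\<in>U. \<eta>n x / \<eta> x = f\<^sub>0 (\<Phi> x)))"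
      using ratio_form[OF sol, of U] by auto
  qed
  show ?thesis
  proof (intro conjI allI impI ballI)
    show "solution_on E a (\<lambda>_. 0) (\<lambda>x. \<eta>s j x / \<eta> x)" if "j \<in> J" for j
      using sol_\<phi>s[OF that] by (simp add: \<phi>s_def[abs_def])
    show "functionally_independent_on E J (\<lambda>j x. \<eta>s j x / \<eta> x)"
      using ind_\<phi>s by (simp add: \<phi>s_def[abs_def])
    show "solution_on E a q (\<lambda>x. \<eta> x * f (\<Phi> x))" if "C1_function_of E \<Phi> f" for f
      by (rule solution_on_mult[OF assms(6) f_sol[OF that]])
    show "\<exists>f\<^sub>0. C1_function_of E \<Phi> f\<^sub>0 \<and> (\<forall>x\<in>E. \<eta>n x / \<eta> x = f\<^sub>0 (\<Phi> x))"
      if "nowhere_locally_zero E a" "solution_on E a q \<eta>n" "connected_level_sets E \<Phi>" for \<eta>n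
      using ratio_form[OF that(2) order_refl] global that by blast
  qed (use f_sol local global third in blast)+
qed

end
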